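(* Let $m,n$ be positive integers, let $\mathcal{M}\in\mathbb{R}^{[2m,n]}$ be a block symmetric and $T$-column sufficient tensor, and let $\mathcal{Q}\in\mathbb{R}^{[m,n]}$. If $\mathrm{TLCP}(\mathcal{M},\mathcal{Q})$ is feasible, then it is solvable.
   Context: Write $[n]=\{1,\dots,n\}$. $\mathbb{R}^{[m,n]}$ denotes the set of $m$-th order $n$-dimensional real tensors $\mathcal{Z}=(z_{i_1\ldots i_m})$ with $i_j\in[n]$ for $j\in[m]$, with entrywise operations and inner product $\langle\mathcal{X},\mathcal{Y}\rangle=\sum_{i_1,\dots,i_m=1}^n x_{i_1\ldots i_m}y_{i_1\ldots i_m}$. $\mathcal{Z}\ge\mathcal{O}$ means all entries of $\mathcal{Z}$ are nonnegative ($\mathcal{O}$ is the zero tensor). For $\mathcal{M}=(m_{i_1\ldots i_{2m}})\in\mathbb{R}^{[2m,n]}$ and $\mathcal{Z}\in\mathbb{R}^{[m,n]}$, the tensor $\mathcal{M}\mathcal{Z}\in\mathbb{R}^{[m,n]}$ is defined by $(\mathcal{M}\mathcal{Z})_{i_1\ldots i_m}=\sum_{i_{m+1},\dots,i_{2m}=1}^n m_{i_1\ldots i_m i_{m+1}\ldots i_{2m}}z_{i_{m+1}\ldots i_{2m}}$. $\mathcal{M}\in\mathbb{R}^{[2m,n]}$ is block symmetric if $m_{i_1\ldots i_m i_{m+1}\ldots i_{2m}}=m_{i_{m+1}\ldots i_{2m} i_1\ldots i_m}$ for all $i_1,\dots,i_{2m}\in[n]$. It is $T$-column sufficient if for every $\mathcal{Z}\in\mathbb{R}^{[m,n]}$: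 if $z_{i_1\ldots i_m}(\mathcal{M}\mathcal{Z})_{i_1\ldots i_m}\le 0$ for all $i_1,\dots,i_m\in[n]$, then $z_{i_1\ldots i_m}(\mathcal{M}\mathcal{Z})_{i_1\ldots i_m}=0$ for all $i_1,\dots,i_m\in[n]$. $\mathrm{TLCP}(\mathcal{M},\mathcal{Q})$ is the problem of finding $\mathcal{Z}\in\mathbb{R}^{[m,n]}$ with $\mathcal{Z}\ge\mathcal{O}$, $\mathcal{M}\mathcal{Z}+\mathcal{Q}\ge\mathcal{O}$ and $\langle\mathcal{Z},\mathcal{M}\mathcal{Z}+\mathcal{Q}\rangle=0$. It is solvable if such a $\mathcal{Z}$ exists, and feasible if there exists $\mathcal{Z}\in\mathbb{R}^{[m,n]}$ with $\mathcal{Z}\ge\mathcal{O}$ and $\mathcal{M}\mathcal{Z}+\mathcal{Q}\ge\mathcal{O}$. *)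

theory Defs
  imports "HOL-Analysis.Analysis"
begin

(* A multi-index i_1 ... i_m is the list [i_1, ..., i_m] with entries in {1..n}. *)

definition multi_indices :: "nat \<Rightarrow> nat \<Rightarrow> nat list set" where
  "multi_indices m n = {i. length i = m \<and> set i \<subseteq> {1..n}}"

type_synonym rtensor = "nat list \<Rightarrow> real"

(* Extending a tensor by 0 outside its index set represents each element of R^[m,n] by exactly
   one function, so that R^[m,n] is closed under the pointwise operations. *)

definition tensors :: "nat \<Rightarrow> nat \<Rightarrow> rtensor set" where
  "tensors m n = {Z. \<forall>i. i \<notin> multi_indices m n \<longrightarrow> Z i = 0}"

definition tensor_add :: "rtensor \<Rightarrow> rtensor \<Rightarrow> rtensor" where
  "tensor_add X Y = (\<lambda>i. X i + Y i)"

definition tensor_inner :: "nat \<Rightarrow> nat \<Rightarrow> rtensor \<Rightarrow> rtensor \<Rightarrow> real" where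
  "tensor_inner m n X Y = (\<Sum>i\<in>multi_indices m n. X i * Y i)"

definition tensor_nonneg :: "nat \<Rightarrow> nat \<Rightarrow> rtensor \<Rightarrow> bool" where
  "tensor_nonneg m n Z \<longleftrightarrow> (\<forall>i\<in>multi_indices m n. 0 \<le> Z i)"

(* The index of an entry of M in R^[2m,n] is the concatenation of two multi-indices of length m. *)

definition tensor_apply :: "nat \<Rightarrow> nat \<Rightarrow> rtensor \<Rightarrow> rtensor \<Rightarrow> rtensor" where
  "tensor_apply m n M Z = (\<lambda>i.
     if i \<in> multi_indices m n then \<Sum>j\<in>multi_indices m n. M (i @ j) * Z j else 0)"

definition block_symmetric :: "nat \<Rightarrow> nat \<Rightarrow> rtensor \<Rightarrow> bool" where
  "block_symmetric m n M \<longleftrightarrow>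
     (\<forall>i\<in>multi_indices m n. \<forall>j\<in>multi_indices m n. M (i @ j) = M (j @ i))"

definition T_column_sufficient :: "nat \<Rightarrow> nat \<Rightarrow> rtensor \<Rightarrow> bool" where
  "T_column_sufficient m n M \<longleftrightarrow>
     (\<forall>Z\<in>tensors m n.
        (\<forall>i\<in>multi_indices m n. Z i * tensor_apply m n M Z i \<le> 0) \<longrightarrow>
        (\<forall>i\<in>multi_indices m n. Z i * tensor_apply m n M Z i = 0))"

definition TLCP_feasible_point :: "nat \<Rightarrow> nat \<Rightarrow> rtensor \<Rightarrow> rtensor \<Rightarrow> rtensor \<Rightarrow> bool" where
  "TLCP_feasible_point m n M Q Z \<longleftrightarrow>
     Z \<in> tensors m n \<and> tensor_nonneg m n Z \<and>
     tensor_nonneg m n (tensor_add (tensor_apply m n M Z) Q)"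

definition TLCP_solution :: "nat \<Rightarrow> nat \<Rightarrow> rtensor \<Rightarrow> rtensor \<Rightarrow> rtensor \<Rightarrow> bool" where
  "TLCP_solution m n M Q Z \<longleftrightarrow>
     TLCP_feasible_point m n M Q Z \<and>
     tensor_inner m n Z (tensor_add (tensor_apply m n M Z) Q) = 0"

definition TLCP_feasible :: "nat \<Rightarrow> nat \<Rightarrow> rtensor \<Rightarrow> rtensor \<Rightarrow> bool" where
  "TLCP_feasible m n M Q \<longleftrightarrow> (\<exists>Z. TLCP_feasible_point m n M Q Z)"

definition TLCP_solvable :: "nat \<Rightarrow> nat \<Rightarrow> rtensor \<Rightarrow> rtensor \<Rightarrow> bool" where
  "TLCP_solvable m n M Q \<longleftrightarrow> (\<exists>Z. TLCP_solution m n M Q Z)"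

end

theory Submission
  imports Defs
begin

text \<open>
  Over the finite set of multi-indices, a tensor of order \<open>2m\<close> is a square matrix, and the problem is a
  linear complementarity problem with a symmetric matrix \<open>A\<close>. Symmetry makes the problem variational:
  its solutions are the points satisfying the first-order optimality conditions of
  \<open>f z = \<langle>z, A z\<rangle> / 2 + \<langle>q, z\<rangle>\<close> on the nonnegative orthant.

  Column sufficiency makes \<open>A\<close> positive semidefinite (\<open>column_sufficient_imp_psd\<close>): an eigenvector \<open>x\<close>
  of a negative eigenvalue \<open>c\<close> would have \<open>x\<^sub>i (A x)\<^sub>i = c x\<^sub>i\<^sup>2 \<le> 0\<close> for all \<open>i\<close>, with strict inequality
  somewhere.

  It remains to find a local minimiser of \<open>f\<close>. On the part of the orthant inside the ball of radius \<open>k\<close>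
  a minimiser \<open>z\<^sub>k\<close> exists, and it satisfies the optimality conditions if it lies strictly inside the
  ball (\<open>interior_minimizer_complementary\<close>). Suppose that \<open>\<bar>z\<^sub>k\<bar> = k\<close> for every \<open>k\<close>, and let \<open>v\<close> be a
  limit point of the directions \<open>z\<^sub>k / k\<close>. Dividing \<open>f z\<^sub>k \<le> f 0 = 0\<close> by \<open>k\<^sup>2\<close> gives \<open>\<langle>v, A v\<rangle> \<le> 0\<close> in
  the limit, hence \<open>A v = 0\<close> by semidefiniteness, and \<open>f\<close> changes at constant rate \<open>\<langle>q, v\<rangle>\<close> along \<open>v\<close>.
  A feasible point \<open>y\<close> gives \<open>\<langle>q, v\<rangle> = \<langle>A y + q, v\<rangle> \<ge> 0\<close>, so stepping back from \<open>z\<^sub>k\<close> to \<open>z\<^sub>k - v\<close> does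
  not increase \<open>f\<close>. When \<open>k\<close> is large and \<open>z\<^sub>k / k\<close> is close to \<open>v\<close>, this point is still nonnegative and
  lies strictly inside the ball, so it is a minimiser of the required kind.
\<close>

section \<open>Matrices over a finite index set\<close>

definition dot :: "'a set \<Rightarrow> ('a \<Rightarrow> real) \<Rightarrow> ('a \<Rightarrow> real) \<Rightarrow> real" where
  "dot I x y = (\<Sum>i\<in>I. x i * y i)"

definition matvec :: "'a set \<Rightarrow> ('a \<Rightarrow> 'a \<Rightarrow> real) \<Rightarrow> ('a \<Rightarrow> real) \<Rightarrow> 'a \<Rightarrow> real" where
  "matvec I A x = (\<lambda>i. \<Sum>j\<in>I. A i j * x j)"

definition symmetric_on :: "'a set \<Rightarrow> ('a \<Rightarrow> 'a \<Rightarrow> real) \<Rightarrow> bool" where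
  "symmetric_on I A \<longleftrightarrow> (\<forall>i\<in>I. \<forall>j\<in>I. A i j = A j i)"

definition psd_on :: "'a set \<Rightarrow> ('a \<Rightarrow> 'a \<Rightarrow> real) \<Rightarrow> bool" where
  "psd_on I A \<longleftrightarrow> (\<forall>x. 0 \<le> dot I x (matvec I A x))"

lemma dot_commute: "dot I x y = dot I y x"
  by (simp add: dot_def mult.commute)

lemma dot_add_right: "dot I x (\<lambda>i. y i + z i) = dot I x y + dot I x z"
  by (simp add: dot_def algebra_simps sum.distrib)

lemma dot_scale_right: "dot I x (\<lambda>i. c * y i) = c * dot I x y"
  by (simp add: dot_def sum_distrib_left algebra_simps)

lemma dot_add_left: "dot I (\<lambda>i. y i + z i) x = dot I y x + dot I z x"
  by (simp add: dot_def algebra_simps sum.distrib)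

lemma dot_scale_left: "dot I (\<lambda>i. c * y i) x = c * dot I y x"
  by (simp add: dot_def sum_distrib_left algebra_simps)

lemma matvec_add: "matvec I A (\<lambda>i. x i + y i) = (\<lambda>i. matvec I A x i + matvec I A y i)"
  by (simp add: matvec_def algebra_simps sum.distrib)

lemma matvec_scale: "matvec I A (\<lambda>i. c * x i) = (\<lambda>i. c * matvec I A x i)"
  by (simp add: matvec_def sum_distrib_left algebra_simps)

lemmas dot_linear = dot_add_left dot_add_right dot_scale_left dot_scale_right matvec_add matvec_scale

lemma dot_nonneg: "(\<And>i. i \<in> I \<Longrightarrow> 0 \<le> x i * y i) \<Longrightarrow> 0 \<le> dot I x y"
  unfolding dot_def by (rule sum_nonneg)

lemma dot_self_nonneg: "0 \<le> dot I x x"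
  by (rule dot_nonneg) simp

lemma dot_cong: "(\<And>i. i \<in> I \<Longrightarrow> x i = x' i) \<Longrightarrow> (\<And>i. i \<in> I \<Longrightarrow> y i = y' i) \<Longrightarrow> dot I x y = dot I x' y'"
  by (simp add: dot_def)

lemma matvec_cong: "(\<And>i. i \<in> I \<Longrightarrow> x i = x' i) \<Longrightarrow> matvec I A x = matvec I A x'"
  by (simp add: matvec_def)

lemma dot_unit:
  assumes "finite I" "k \<in> I"
  shows "dot I (\<lambda>i. of_bool (i = k)) y = y k"
proof -
  have "dot I (\<lambda>i. of_bool (i = k)) y = (\<Sum>i\<in>I. if i = k then y i else 0)"
    unfolding dot_def by (rule sum.cong) auto
  then show ?thesis using assms by simp
qed

lemma symmetric_on_dot_matvec:
  assumes "symmetric_on I A"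
  shows "dot I x (matvec I A y) = dot I y (matvec I A x)"
proof -
  have "dot I x (matvec I A y) = (\<Sum>i\<in>I. \<Sum>j\<in>I. x i * A i j * y j)"
    by (simp add: dot_def matvec_def sum_distrib_left algebra_simps)
  also have "\<dots> = (\<Sum>j\<in>I. \<Sum>i\<in>I. x i * A i j * y j)" by (rule sum.swap)
  also have "\<dots> = (\<Sum>j\<in>I. \<Sum>i\<in>I. y j * A j i * x i)"
    using assms by (intro sum.cong refl) (simp add: symmetric_on_def)
  also have "\<dots> = dot I y (matvec I A x)"
    by (simp add: dot_def matvec_def sum_distrib_left algebra_simps)
  finally show ?thesis .
qed

lemma right_slope_nonneg:
  fixes a b :: real
  assumes "\<forall>\<^sub>F t in at_right 0. 0 \<le> t * a + t\<^sup>2 * b"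
  shows "0 \<le> a"
proof -
  have "\<forall>\<^sub>F t in at_right (0::real). 0 < t"
    by (simp add: eventually_at_right_less)
  with assms have "\<forall>\<^sub>F t in at_right 0. 0 \<le> a + t * b"
  proof eventually_elim
    case (elim t)
    then have "0 \<le> t * (a + t * b)" by (simp add: algebra_simps power2_eq_square)
    with elim show ?case by (simp add: zero_le_mult_iff)
  qed
  moreover have "((\<lambda>t. a + t * b) \<longlongrightarrow> a + 0 * b) (at_right 0)"
    by (intro tendsto_intros)
  ultimately have "0 \<le> a + 0 * b"
    by (intro tendsto_lowerbound[OF _ _ trivial_limit_at_right_real])
  then show ?thesis by simp
qed

text \<open>
  An isotropic vector \<open>x\<close> is a global minimiser of the quadratic form, so the derivative \<open>2 (A x)\<^sub>k\<close> of the
  form along each coordinate direction vanishes at \<open>x\<close>.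
\<close>
lemma psd_isotropic_imp_kernel:
  assumes I: "finite I" and sym: "symmetric_on I A" and psd: "psd_on I A"
    and x: "dot I x (matvec I A x) = 0" and k: "k \<in> I"
  shows "matvec I A x k = 0"
proof -
  define e :: "'a \<Rightarrow> real" where "e = (\<lambda>i. of_bool (i = k))"
  have slope: "0 \<le> s * (2 * matvec I A x k)" if "s\<^sup>2 = 1" for s :: real
  proof (rule right_slope_nonneg)
    show "\<forall>\<^sub>F t in at_right 0. 0 \<le> t * (s * (2 * matvec I A x k)) + t\<^sup>2 * dot I e (matvec I A e)"
    proof (rule always_eventually, rule allI)
      fix t :: real
      have "0 \<le> dot I (\<lambda>i. x i + (t * s) * e i) (matvec I A (\<lambda>i. x i + (t * s) * e i))"
        using psd by (simp only: psd_on_def)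
      also have "\<dots> = (t * s) * (2 * dot I e (matvec I A x)) + (t * s)\<^sup>2 * dot I e (matvec I A e)"
        using x symmetric_on_dot_matvec[OF sym, of x e]
        by (simp add: dot_linear algebra_simps power2_eq_square del: mult_cancel_left)
      finally show "0 \<le> t * (s * (2 * matvec I A x k)) + t\<^sup>2 * dot I e (matvec I A e)"
        using that dot_unit[OF I k] by (simp add: e_def power_mult_distrib mult.assoc)
    qed
  qed
  from slope[of 1] slope[of "-1"] show ?thesis by simp
qed

section \<open>Compactness of bounded sets of vectors\<close>

lemma tendsto_dot:
  assumes "\<And>i. ((\<lambda>k. x k i) \<longlongrightarrow> x' i) F" "\<And>i. ((\<lambda>k. y k i) \<longlongrightarrow> y' i) F"
  shows "((\<lambda>k. dot I (x k) (y k)) \<longlongrightarrow> dot I x' y') F"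
  unfolding dot_def by (intro tendsto_intros assms)

lemma tendsto_matvec:
  assumes "\<And>i. ((\<lambda>k. x k i) \<longlongrightarrow> x' i) F"
  shows "((\<lambda>k. matvec I A (x k) i) \<longlongrightarrow> matvec I A x' i) F"
  unfolding matvec_def by (intro tendsto_intros assms)

lemma continuous_on_coord: "continuous_on S (\<lambda>x::'a \<Rightarrow> real. x i)"
  by (rule continuous_on_subset[OF continuous_on_product_coordinates]) simp

lemma continuous_on_dot:
  assumes "\<And>i. continuous_on S (\<lambda>z. x z i)" "\<And>i. continuous_on S (\<lambda>z. y z i)"
  shows "continuous_on S (\<lambda>z. dot I (x z) (y z))"
  unfolding dot_def by (intro continuous_intros assms)

lemma continuous_on_matvec: "continuous_on S (\<lambda>z. matvec I A z i)"
  unfolding matvec_def by (intro continuous_intros continuous_on_coord)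

lemma abs_le_of_dot_self_le:
  assumes "finite I" "i \<in> I" "dot I x x \<le> r\<^sup>2" "0 \<le> r"
  shows "\<bar>x i\<bar> \<le> r"
proof -
  have "x i * x i \<le> dot I x x"
    unfolding dot_def using assms by (intro member_le_sum) auto
  with assms show ?thesis
    by (metis abs_le_square_iff abs_of_nonneg order_trans power2_eq_square)
qed

text \<open>
  Vectors indexed by \<open>I\<close> are represented by functions vanishing off \<open>I\<close>; a bound on the norm then confines
  a closed set of them to a product of compact intervals, to which Tychonoff's theorem applies.
\<close>
lemma compact_bounded_vectors:
  fixes C :: "('a \<Rightarrow> real) set"
  assumes I: "finite I" and C: "closed C"
    and supp: "\<And>z i. z \<in> C \<Longrightarrow> i \<notin> I \<Longrightarrow> z i = 0"
    and bd: "\<And>z. z \<in> C \<Longrightarrow> dot I z z \<le> r\<^sup>2" and r: "0 \<le> r"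
  shows "compact C"
proof -
  define S where "S = (\<lambda>i. if i \<in> I then {-r..r} else {0::real})"
  have "compactin (product_topology (\<lambda>i. euclidean) UNIV) (PiE UNIV S)"
    by (auto simp: compactin_PiE S_def)
  then have "compact (PiE UNIV S)"
    by (simp add: euclidean_product_topology)
  moreover have "C \<subseteq> PiE UNIV S"
  proof
    fix z assume z: "z \<in> C"
    have "z i \<in> S i" for i
      using abs_le_of_dot_self_le[OF I _ bd[OF z] r, of i] supp[OF z, of i]
      by (auto simp: S_def abs_le_iff)
    then show "z \<in> PiE UNIV S" by auto
  qed
  ultimately show ?thesis
    using C by (metis compact_Int_closed inf.absorb_iff2)
qed

lemma closed_supported: "closed {z::'a \<Rightarrow> real. \<forall>i. i \<notin> I \<longrightarrow> z i = 0}"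
  by (intro closed_Collect_all closed_Collect_imp open_Collect_const closed_Collect_eq
        continuous_on_coord continuous_intros)

lemma closed_orthant: "closed {z::'a \<Rightarrow> real. \<forall>i. 0 \<le> z i}"
  by (intro closed_Collect_all closed_Collect_le continuous_on_coord continuous_intros)

section \<open>Column sufficiency and semidefiniteness\<close>

text \<open>
  The minimum \<open>c\<close> of the quadratic form on the unit sphere is attained at some \<open>x\<close>. The matrix \<open>A - c\<close> is
  then semidefinite with isotropic vector \<open>x\<close>, which makes \<open>x\<close> an eigenvector of \<open>A\<close> for \<open>c\<close>.
\<close>
lemma symmetric_minimal_eigenvector:
  assumes I: "finite I" "I \<noteq> {}" and sym: "symmetric_on I A"
  obtains x c where "\<And>i. i \<notin> I \<Longrightarrow> x i = 0" "dot I x x = 1"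
    "\<And>i. i \<in> I \<Longrightarrow> matvec I A x i = c * x i"
    "\<And>y. c * dot I y y \<le> dot I y (matvec I A y)"
proof -
  let ?q = "\<lambda>z. dot I z (matvec I A z)"
  define S where "S = {z::'a \<Rightarrow> real. \<forall>i. i \<notin> I \<longrightarrow> z i = 0} \<inter> {z. dot I z z = 1}"
  have "closed S"
    unfolding S_def
    by (intro closed_Int closed_supported closed_Collect_eq continuous_on_dot continuous_on_coord
          continuous_intros)
  then have "compact S"
    by (rule compact_bounded_vectors[OF I(1), of _ 1]) (auto simp: S_def)
  moreover obtain k where k: "k \<in> I" using I by blast
  have "(\<lambda>i. of_bool (i = k)) \<in> S"
    using k dot_unit[OF I(1) k] by (auto simp: S_def)
  then have "S \<noteq> {}" by blast
  moreover have "continuous_on S ?q"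
    by (intro continuous_on_dot continuous_on_coord continuous_on_matvec)
  ultimately obtain x where x: "x \<in> S" and min: "\<And>y. y \<in> S \<Longrightarrow> ?q x \<le> ?q y"
    using continuous_attains_inf[of S ?q] by blast
  define c where "c = ?q x"
  have supp: "\<And>i. i \<notin> I \<Longrightarrow> x i = 0" and nrm: "dot I x x = 1"
    using x by (auto simp: S_def)
  have bound: "c * dot I y y \<le> ?q y" for y
  proof (cases "dot I y y = 0")
    case True
    then have "y i = 0" if "i \<in> I" for i
      using abs_le_of_dot_self_le[OF I(1) that, of y 0] by simp
    then have "?q y = 0" by (simp add: dot_def)
    with True show ?thesis by simp
  next
    case False
    define s where "s = sqrt (dot I y y)"
    have s: "s > 0" "s\<^sup>2 = dot I y y"
      using False dot_self_nonneg[of I y] by (simp_all add: s_def)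
    define u where "u = (\<lambda>i. if i \<in> I then (1 / s) * y i else 0)"
    have "dot I u u = dot I (\<lambda>i. (1 / s) * y i) (\<lambda>i. (1 / s) * y i)"
      by (rule dot_cong) (simp_all add: u_def)
    also have "\<dots> = 1"
      unfolding dot_linear s(2)[symmetric] using s(1) by (simp add: power2_eq_square)
    finally have "u \<in> S" by (simp add: S_def u_def)
    then have "c \<le> ?q u" unfolding c_def by (rule min)
    also have "matvec I A u = matvec I A (\<lambda>i. (1 / s) * y i)"
      by (rule matvec_cong) (simp add: u_def)
    then have "?q u = dot I (\<lambda>i. (1 / s) * y i) (matvec I A (\<lambda>i. (1 / s) * y i))"
      by (intro dot_cong) (simp_all add: u_def)
    also have "\<dots> = ?q y / dot I y y"
      unfolding dot_linear s(2)[symmetric] by (simp add: power2_eq_square)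
    finally show ?thesis
      using False dot_self_nonneg[of I y] by (simp add: pos_le_divide_eq)
  qed
  define B where "B = (\<lambda>i j. A i j - c * of_bool (j = i))"
  have B: "matvec I B y i = matvec I A y i + (- c) * y i" if "i \<in> I" for y i
  proof -
    have "matvec I B y i = matvec I A y i - c * dot I (\<lambda>j. of_bool (j = i)) y"
      by (simp add: matvec_def dot_def B_def left_diff_distrib sum_subtractf sum_distrib_left mult.assoc)
    then show ?thesis by (simp only: dot_unit[OF I(1) that])
  qed
  have qB: "dot I y (matvec I B y) = ?q y - c * dot I y y" for y
  proof -
    have "dot I y (matvec I B y) = dot I y (\<lambda>i. matvec I A y i + (- c) * y i)"
      by (rule dot_cong) (simp_all add: B)
    then show ?thesis unfolding dot_linear by simp
  qed
  have "symmetric_on I B"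
    using sym by (auto simp: symmetric_on_def B_def)
  moreover have "psd_on I B"
    using bound by (simp add: psd_on_def qB)
  moreover have "dot I x (matvec I B x) = 0"
    by (simp add: qB nrm c_def)
  ultimately have "matvec I B x i = 0" if "i \<in> I" for i
    using psd_isotropic_imp_kernel[OF I(1)] that by blast
  then have eig: "\<And>i. i \<in> I \<Longrightarrow> matvec I A x i = c * x i" by (simp add: B)
  show thesis by (rule that[OF supp nrm eig bound])
qed

lemma column_sufficient_imp_psd:
  assumes I: "finite I" and sym: "symmetric_on I A"
    and suff: "\<And>x. (\<And>i. i \<notin> I \<Longrightarrow> x i = 0) \<Longrightarrow> (\<And>i. i \<in> I \<Longrightarrow> x i * matvec I A x i \<le> 0) \<Longrightarrow>
                 (\<And>i. i \<in> I \<Longrightarrow> x i * matvec I A x i = 0)"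
  shows "psd_on I A"
proof (cases "I = {}")
  case True
  then show ?thesis by (simp add: psd_on_def dot_def)
next
  case False
  then obtain x c where x: "\<And>i. i \<notin> I \<Longrightarrow> x i = 0" "dot I x x = 1"
    "\<And>i. i \<in> I \<Longrightarrow> matvec I A x i = c * x i"
    and min: "\<And>y. c * dot I y y \<le> dot I y (matvec I A y)"
    using symmetric_minimal_eigenvector[OF I _ sym] by metis
  have "0 \<le> c"
  proof (rule ccontr)
    assume c: "\<not> 0 \<le> c"
    have "x i * matvec I A x i \<le> 0" if "i \<in> I" for i
    proof -
      have "x i * matvec I A x i = c * (x i * x i)" unfolding x(3)[OF that] by simp
      also have "\<dots> \<le> 0" using c by (simp add: mult_nonpos_nonneg)
      finally show ?thesis .
    qed
    then have "x i * matvec I A x i = 0" if "i \<in> I" for i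
      using suff[of x] x(1) that by blast
    then have "x i = 0" if "i \<in> I" for i
      using x(3)[OF that] c that by (metis mult_eq_0_iff order_refl)
    then have "dot I x x = 0" by (simp add: dot_def)
    with x(2) show False by simp
  qed
  then show ?thesis
    unfolding psd_on_def using min dot_self_nonneg
    by (meson mult_nonneg_nonneg order_trans)
qed

section \<open>The quadratic program\<close>

definition objective :: "'a set \<Rightarrow> ('a \<Rightarrow> 'a \<Rightarrow> real) \<Rightarrow> ('a \<Rightarrow> real) \<Rightarrow> ('a \<Rightarrow> real) \<Rightarrow> real" where
  "objective I A q z = dot I z (matvec I A z) / 2 + dot I q z"

definition orthant_ball :: "'a set \<Rightarrow> real \<Rightarrow> ('a \<Rightarrow> real) set" where
  "orthant_ball I r = {z. (\<forall>i. i \<notin> I \<longrightarrow> z i = 0) \<and> (\<forall>i. 0 \<le> z i) \<and> dot I z z \<le> r\<^sup>2}"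

lemma objective_step:
  assumes "symmetric_on I A"
  shows "objective I A q (\<lambda>i. z i + t * d i) =
    objective I A q z + t * dot I d (\<lambda>i. matvec I A z i + q i) + t\<^sup>2 * (dot I d (matvec I A d) / 2)"
  unfolding objective_def dot_linear
  using symmetric_on_dot_matvec[OF assms, of z d] dot_commute[of I q d]
  by (simp add: algebra_simps power2_eq_square add_divide_distrib)

lemma orthant_ball_minimizer:
  assumes I: "finite I" and r: "0 \<le> r"
  obtains z where "z \<in> orthant_ball I r"
    "\<And>y. y \<in> orthant_ball I r \<Longrightarrow> objective I A q z \<le> objective I A q y"
proof -
  have eq: "orthant_ball I r =
      {z. \<forall>i. i \<notin> I \<longrightarrow> z i = 0} \<inter> {z. \<forall>i. 0 \<le> z i} \<inter> {z. dot I z z \<le> r\<^sup>2}"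
    by (auto simp: orthant_ball_def)
  have "closed (orthant_ball I r)"
    unfolding eq
    by (intro closed_Int closed_supported closed_orthant closed_Collect_le continuous_on_dot
          continuous_on_coord continuous_intros)
  then have "compact (orthant_ball I r)"
    by (rule compact_bounded_vectors[OF I, of _ r]) (use r in \<open>auto simp: orthant_ball_def\<close>)
  moreover have "(\<lambda>i. 0) \<in> orthant_ball I r"
    by (simp add: orthant_ball_def dot_def)
  moreover have "continuous_on (orthant_ball I r) (objective I A q)"
    unfolding objective_def
    by (intro continuous_on_add continuous_on_divide continuous_on_dot continuous_on_coord
          continuous_on_matvec continuous_on_const) simp
  ultimately show thesis
    using continuous_attains_inf[of "orthant_ball I r" "objective I A q"] that by blast
qed

text \<open>
  Two kinds of admissible directions suffice: increasing a single coordinate shows that the gradient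
  \<open>A z + q\<close> is nonnegative, and shrinking \<open>z\<close> towards the origin shows \<open>\<langle>z, A z + q\<rangle> \<le> 0\<close>. Only the former
  may increase the norm, and this is where the strict bound is used.
\<close>
lemma interior_minimizer_complementary:
  assumes I: "finite I" and sym: "symmetric_on I A"
    and z: "z \<in> orthant_ball I r" and int: "dot I z z < r\<^sup>2"
    and min: "\<And>y. y \<in> orthant_ball I r \<Longrightarrow> objective I A q z \<le> objective I A q y"
  shows "\<And>i. i \<in> I \<Longrightarrow> 0 \<le> matvec I A z i + q i"
    and "dot I z (\<lambda>i. matvec I A z i + q i) = 0"
proof -
  let ?w = "\<lambda>i. matvec I A z i + q i"
  have direction: "0 \<le> dot I d ?w"
    if "\<forall>\<^sub>F t in at_right 0. (\<lambda>i. z i + t * d i) \<in> orthant_ball I r" for d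
  proof (rule right_slope_nonneg)
    show "\<forall>\<^sub>F t in at_right 0. 0 \<le> t * dot I d ?w + t\<^sup>2 * (dot I d (matvec I A d) / 2)"
      using that
    proof eventually_elim
      case (elim t)
      from min[OF elim] show ?case by (simp add: objective_step[OF sym])
    qed
  qed
  have z0: "\<And>i. i \<notin> I \<Longrightarrow> z i = 0" "\<And>i. 0 \<le> z i"
    using z by (auto simp: orthant_ball_def)
  show w: "0 \<le> ?w k" if k: "k \<in> I" for k
  proof -
    define e :: "'a \<Rightarrow> real" where "e = (\<lambda>i. of_bool (i = k))"
    have "((\<lambda>t. dot I (\<lambda>i. z i + t * e i) (\<lambda>i. z i + t * e i)) \<longlongrightarrow>
        dot I (\<lambda>i. z i + 0 * e i) (\<lambda>i. z i + 0 * e i)) (at_right 0)"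
      by (intro tendsto_dot tendsto_intros)
    then have "\<forall>\<^sub>F t in at_right 0. dot I (\<lambda>i. z i + t * e i) (\<lambda>i. z i + t * e i) < r\<^sup>2"
      using int by (intro order_tendstoD(2)) simp_all
    moreover have "\<forall>\<^sub>F t in at_right (0::real). 0 < t"
      by (simp add: eventually_at_right_less)
    ultimately have "\<forall>\<^sub>F t in at_right 0. (\<lambda>i. z i + t * e i) \<in> orthant_ball I r"
      by eventually_elim (use k z0 in \<open>auto simp: orthant_ball_def e_def\<close>)
    then have "0 \<le> dot I e ?w" by (rule direction)
    then show ?thesis unfolding e_def dot_unit[OF I k] .
  qed
  have "\<forall>\<^sub>F t in at_right (0::real). t \<in> {0<..<1}"
    by (rule eventually_at_right_real) simp
  then have "\<forall>\<^sub>F t in at_right 0. (\<lambda>i. z i + t * - z i) \<in> orthant_ball I r"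
  proof eventually_elim
    case (elim t)
    have eq: "(\<lambda>i. z i + t * - z i) = (\<lambda>i. (1 - t) * z i)" by (simp add: algebra_simps)
    have "dot I (\<lambda>i. (1 - t) * z i) (\<lambda>i. (1 - t) * z i) = (1 - t)\<^sup>2 * dot I z z"
      unfolding dot_linear by (simp add: power2_eq_square)
    also have "\<dots> \<le> 1 * dot I z z"
      using elim by (intro mult_right_mono dot_self_nonneg) (simp add: power_le_one)
    finally show ?case
      using elim z0 int unfolding eq by (auto simp: orthant_ball_def)
  qed
  then have "0 \<le> dot I (\<lambda>i. - z i) ?w" by (rule direction)
  then have "dot I z ?w \<le> 0" by (simp add: dot_def sum_negf)
  moreover have "0 \<le> dot I z ?w"
    by (intro dot_nonneg mult_nonneg_nonneg w z0)
  ultimately show "dot I z ?w = 0" by simp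
qed

text \<open>
  Minimisers on balls whose radii tend to infinity cannot all be forced to the boundary: the limit of
  their directions lies in the kernel of \<open>A\<close>, and feasibility makes a unit step back along it harmless for
  the objective. Countability of the index type makes the function space first countable, so that
  compactness yields a convergent subsequence of the directions.
\<close>
lemma feasible_imp_interior_minimizer:
  fixes I :: "'a::countable set"
  assumes I: "finite I" and sym: "symmetric_on I A" and psd: "psd_on I A"
    and y: "\<And>i. i \<in> I \<Longrightarrow> 0 \<le> matvec I A y i + q i"
  obtains z r where "z \<in> orthant_ball I r" "dot I z z < r\<^sup>2"
    "\<And>x. x \<in> orthant_ball I r \<Longrightarrow> objective I A q z \<le> objective I A q x"
proof -
  define r where "r = (\<lambda>k. real (Suc k))"
  have r: "r k > 0" for k by (simp add: r_def)
  have "\<exists>z. z \<in> orthant_ball I (r k) \<and>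
      (\<forall>x\<in>orthant_ball I (r k). objective I A q z \<le> objective I A q x)" for k
    using orthant_ball_minimizer[OF I, of "r k" A q] r[of k] by (metis less_imp_le)
  then obtain Z where Z: "\<And>k. Z k \<in> orthant_ball I (r k)"
    and min: "\<And>k x. x \<in> orthant_ball I (r k) \<Longrightarrow> objective I A q (Z k) \<le> objective I A q x"
    by metis
  show thesis
  proof (cases "\<exists>k. dot I (Z k) (Z k) < (r k)\<^sup>2")
    case True
    then show thesis using that Z min by blast
  next
    case False
    then have nrm: "dot I (Z k) (Z k) = (r k)\<^sup>2" for k
      using Z[of k] by (auto simp: orthant_ball_def not_less intro: order_antisym)
    have Z0: "\<And>i k. i \<notin> I \<Longrightarrow> Z k i = 0" "\<And>k i. 0 \<le> Z k i"
      using Z by (auto simp: orthant_ball_def)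
    define V where "V = (\<lambda>k i. (1 / r k) * Z k i)"
    define S where "S = {z::'a \<Rightarrow> real. \<forall>i. i \<notin> I \<longrightarrow> z i = 0} \<inter> {z. \<forall>i. 0 \<le> z i} \<inter> {z. dot I z z = 1}"
    have "closed S"
      unfolding S_def
      by (intro closed_Int closed_supported closed_orthant closed_Collect_eq continuous_on_dot
            continuous_on_coord continuous_intros)
    then have "compact S"
      by (rule compact_bounded_vectors[OF I, of _ 1]) (auto simp: S_def)
    then have "seq_compact S" by (rule compact_imp_seq_compact)
    moreover have VS: "V k \<in> S" for k
    proof -
      have "dot I (V k) (V k) = 1"
        unfolding V_def dot_linear using r[of k] by (simp add: nrm power2_eq_square)
      then show ?thesis using Z0 r[of k] by (simp add: S_def V_def)
    qed
    ultimately obtain v \<sigma> where v: "v \<in> S" and \<sigma>: "strict_mono \<sigma>" and "(V \<circ> \<sigma>) \<longlonglongrightarrow> v"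
      unfolding seq_compact_def by blast
    then have lim: "(\<lambda>k. V (\<sigma> k) i) \<longlonglongrightarrow> v i" for i
      using continuous_on_tendsto_compose[OF continuous_on_coord[of UNIV i]] by (simp add: o_def)
    have v0: "\<And>i. i \<notin> I \<Longrightarrow> v i = 0" "\<And>i. 0 \<le> v i" "dot I v v = 1"
      using v by (auto simp: S_def)
    have r_lim: "filterlim (\<lambda>k. r (\<sigma> k)) at_top sequentially"
      unfolding r_def
      by (rule filterlim_compose[OF filterlim_real_sequentially],
          rule filterlim_compose[OF filterlim_Suc filterlim_subseq[OF \<sigma>]])
    have ZV: "Z k = (\<lambda>i. r k * V k i)" for k
      using r[of k] by (simp add: V_def)
    have descent: "r k * (dot I (V k) (matvec I A (V k)) / 2) + dot I q (V k) \<le> 0" for k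
    proof -
      have "objective I A q (Z k) \<le> objective I A q (\<lambda>i. 0)"
        by (rule min) (simp add: orthant_ball_def dot_def)
      also have "\<dots> = 0" by (simp add: objective_def dot_def)
      finally have "r k * (r k * (dot I (V k) (matvec I A (V k)) / 2) + dot I q (V k)) \<le> 0"
        unfolding ZV objective_def dot_linear by (simp add: algebra_simps)
      then show ?thesis using r[of k] by (simp add: mult_le_0_iff)
    qed
    have psdV: "0 \<le> dot I x (matvec I A x)" for x
      using psd by (simp add: psd_on_def)
    \<comment> \<open>Dividing \<open>descent\<close> by the radius leaves only the quadratic term in the limit.\<close>
    have "(\<lambda>k. dot I (V (\<sigma> k)) (matvec I A (V (\<sigma> k))) / 2 + (1 / r (\<sigma> k)) * dot I q (V (\<sigma> k)))
        \<longlonglongrightarrow> dot I v (matvec I A v) / 2 + 0 * dot I q v"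
      by (intro tendsto_intros tendsto_dot tendsto_matvec lim
            tendsto_divide_0[OF tendsto_const] filterlim_at_top_imp_at_infinity r_lim) simp
    moreover have "dot I (V (\<sigma> k)) (matvec I A (V (\<sigma> k))) / 2 + (1 / r (\<sigma> k)) * dot I q (V (\<sigma> k)) \<le> 0"
      for k
      using descent[of "\<sigma> k"] r[of "\<sigma> k"] by (simp add: field_simps)
    ultimately have "dot I v (matvec I A v) / 2 + 0 * dot I q v \<le> 0"
      by (intro LIMSEQ_le_const2) auto
    then have "dot I v (matvec I A v) = 0" using psdV[of v] by simp
    then have Av: "matvec I A v i = 0" if "i \<in> I" for i
      using psd_isotropic_imp_kernel[OF I sym psd] that by blast
    have Av_dot: "dot I x (matvec I A v) = 0" for x
      using Av by (simp add: dot_def)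
    have qv: "0 \<le> dot I v q"
    proof -
      have "0 \<le> dot I v (\<lambda>i. matvec I A y i + q i)"
        by (intro dot_nonneg mult_nonneg_nonneg y v0)
      then show ?thesis
        by (simp add: dot_linear symmetric_on_dot_matvec[OF sym, of v y] Av_dot)
    qed
    have far: "\<forall>\<^sub>F k in sequentially. v i \<le> Z (\<sigma> k) i" if "i \<in> I" for i
    proof (cases "v i = 0")
      case True
      then show ?thesis using Z0(2) by simp
    next
      case False
      then have "0 < v i" using v0(2)[of i] by simp
      then have "filterlim (\<lambda>k. V (\<sigma> k) i * r (\<sigma> k)) at_top sequentially"
        by (rule filterlim_tendsto_pos_mult_at_top[OF lim _ r_lim])
      then show ?thesis
        by (simp add: filterlim_at_top ZV mult.commute)
    qed
    have "(\<lambda>k. dot I v (V (\<sigma> k))) \<longlonglongrightarrow> dot I v v"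
      by (intro tendsto_dot lim tendsto_const)
    then have "filterlim (\<lambda>k. dot I v (V (\<sigma> k)) * r (\<sigma> k)) at_top sequentially"
      by (rule filterlim_tendsto_pos_mult_at_top[OF _ _ r_lim]) (simp add: v0)
    then have "\<forall>\<^sub>F k in sequentially. 1 \<le> dot I v (V (\<sigma> k)) * r (\<sigma> k)"
      by (simp add: filterlim_at_top)
    moreover have "\<forall>\<^sub>F k in sequentially. \<forall>i\<in>I. v i \<le> Z (\<sigma> k) i"
      using far by (simp add: eventually_ball_finite_distrib[OF I])
    ultimately have "\<forall>\<^sub>F k in sequentially. 1 \<le> dot I v (V (\<sigma> k)) * r (\<sigma> k) \<and> (\<forall>i\<in>I. v i \<le> Z (\<sigma> k) i)"
      by eventually_elim blast
    then obtain k where k: "1 \<le> dot I v (V (\<sigma> k)) * r (\<sigma> k)" "\<And>i. i \<in> I \<Longrightarrow> v i \<le> Z (\<sigma> k) i"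
      by (auto simp: eventually_sequentially)
    \<comment> \<open>As \<open>\<langle>v, Z\<rangle> \<ge> 1\<close>, the step to \<open>u\<close> changes the squared norm by \<open>1 - 2 \<langle>v, Z\<rangle> < 0\<close>.\<close>
    define u where "u = (\<lambda>i. Z (\<sigma> k) i + (-1) * v i)"
    have "dot I v (Z (\<sigma> k)) \<ge> 1"
      using k(1) unfolding ZV dot_linear by (simp add: mult.commute)
    then have u_int: "dot I u u < (r (\<sigma> k))\<^sup>2"
      unfolding u_def dot_linear using v0(3) nrm[of "\<sigma> k"] dot_commute[of I v "Z (\<sigma> k)"] by simp
    moreover have "0 \<le> u i" for i
      using k(2)[of i] Z0(1)[of i] v0(1)[of i] by (cases "i \<in> I") (auto simp: u_def)
    ultimately have u: "u \<in> orthant_ball I (r (\<sigma> k))"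
      using Z0(1) v0(1) by (simp add: orthant_ball_def u_def)
    have "objective I A q u \<le> objective I A q (Z (\<sigma> k))"
      unfolding u_def objective_step[OF sym]
      using qv by (simp add: dot_linear Av_dot symmetric_on_dot_matvec[OF sym, of v "Z (\<sigma> k)"])
    then have "\<And>x. x \<in> orthant_ball I (r (\<sigma> k)) \<Longrightarrow> objective I A q u \<le> objective I A q x"
      using min by (meson order_trans)
    with u u_int show thesis by (rule that)
  qed
qed

section \<open>Tensor complementarity\<close>

lemma finite_multi_indices: "finite (multi_indices m n)"
  using finite_lists_length_eq[of "{1..n}" m] by (simp add: multi_indices_def conj_commute)

theorem theorem4p3:
  fixes m n :: nat and M Q :: rtensor
  assumes "m > 0" and "n > 0"
    and "M \<in> tensors (2 * m) n"
    and "block_symmetric m n M"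
    and "T_column_sufficient m n M"
    and "Q \<in> tensors m n"
    and "TLCP_feasible m n M Q"
  shows "TLCP_solvable m n M Q"
proof -
  define I where "I = multi_indices m n"
  define A where "A = (\<lambda>i j. M (i @ j))"
  have I: "finite I" unfolding I_def by (rule finite_multi_indices)
  have apply_eq: "tensor_apply m n M Z i = matvec I A Z i" if "i \<in> I" for Z i
    using that by (simp add: tensor_apply_def matvec_def I_def A_def)
  have sym: "symmetric_on I A"
    using assms(4) by (simp add: symmetric_on_def block_symmetric_def I_def A_def)
  have psd: "psd_on I A"
  proof (rule column_sufficient_imp_psd[OF I sym])
    fix x :: rtensor and i
    assume x: "\<And>i. i \<notin> I \<Longrightarrow> x i = 0" "\<And>i. i \<in> I \<Longrightarrow> x i * matvec I A x i \<le> 0" and i: "i \<in> I"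
    have "x \<in> tensors m n" using x(1) by (simp add: tensors_def I_def)
    moreover have "\<forall>i\<in>multi_indices m n. x i * tensor_apply m n M x i \<le> 0"
      using x(2) apply_eq by (simp add: I_def)
    ultimately show "x i * matvec I A x i = 0"
      using assms(5) i apply_eq[OF i] unfolding T_column_sufficient_def I_def by metis
  qed
  obtain Y where Y: "TLCP_feasible_point m n M Q Y"
    using assms(7) by (auto simp: TLCP_feasible_def)
  have "0 \<le> matvec I A Y i + Q i" if "i \<in> I" for i
  proof -
    have "0 \<le> tensor_apply m n M Y i + Q i"
      using Y that by (simp add: TLCP_feasible_point_def tensor_nonneg_def tensor_add_def I_def)
    then show ?thesis by (simp only: apply_eq[OF that])
  qed
  from feasible_imp_interior_minimizer[OF I sym psd this]
  obtain z r where z: "z \<in> orthant_ball I r" "dot I z z < r\<^sup>2"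
    "\<And>x. x \<in> orthant_ball I r \<Longrightarrow> objective I A Q z \<le> objective I A Q x"
    by blast
  note opt = interior_minimizer_complementary[OF I sym z]
  have "TLCP_feasible_point m n M Q z"
    using z(1) opt(1) apply_eq
    by (auto simp: TLCP_feasible_point_def orthant_ball_def tensors_def tensor_nonneg_def
        tensor_add_def I_def)
  moreover have "tensor_inner m n z (tensor_add (tensor_apply m n M z) Q) =
      dot I z (\<lambda>i. matvec I A z i + Q i)"
    using apply_eq by (simp add: tensor_inner_def tensor_add_def dot_def I_def)
  ultimately show ?thesis
    using opt(2) by (auto simp: TLCP_solvable_def TLCP_solution_def)
qed

end
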